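(* Let $\alpha \in \mathbb{R}$ and let $Z \sim BASN_2(\alpha)$. Then the moment generating function $M_Z(t) = E(e^{tZ})$ of $Z$ is given, for all $t\in\mathbb{R}$, by $$M_Z(t) = \frac{M_X(t)\left[\alpha^4 t^4 + 6\alpha^4 t^2 + 3\alpha^4 - 4\alpha^3 t^3 - 12\alpha^3 t + 8\alpha^2 t^2 + 8\alpha^2 - 8\alpha t + 4\right]}{C_2(\alpha)(2+\alpha^2)^2},$$ where $M_X(t) = e^{t^2/2}$ is the moment generating function of a standard normal random variable $X$.
   Context: Here $\varphi(z) = \frac{1}{\sqrt{2\pi}} e^{-z^2/2}$ is the standard normal probability density function. For $\alpha\in\mathbb{R}$, put $C_2(\alpha) = 3 - \frac{4}{2+\alpha^2}$. A real random variable $Z$ follows the Balakrishnan alpha skew normal distribution with parameter $\alpha$, written $Z\sim BASN_2(\alpha)$, if it has the probability density function $$f_Z(z;\alpha) = \frac{1}{C_2(\alpha)}\left(\frac{(1-\alpha z)^2+1}{2+\alpha^2}\right)^2\varphi(z),\qquad z\in\mathbb{R}.$$ *)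

theory Defs
  imports "HOL-Probability.Probability"
begin

definition C2 :: "real \<Rightarrow> real" where
  "C2 \<alpha> = 3 - 4 / (2 + \<alpha>\<^sup>2)"

definition basn2_density :: "real \<Rightarrow> real \<Rightarrow> real" where
  "basn2_density \<alpha> z =
     1 / C2 \<alpha> * (((1 - \<alpha> * z)\<^sup>2 + 1) / (2 + \<alpha>\<^sup>2))\<^sup>2 * std_normal_density z"

(* The Bochner integral of a non-integrable function is 0, so mgf M Z t is the expectation
   only together with integrability of exp (t * Z). *)
definition mgf :: "'a measure \<Rightarrow> ('a \<Rightarrow> real) \<Rightarrow> real \<Rightarrow> real" where
  "mgf M Z t = integral\<^sup>L M (\<lambda>\<omega>. exp (t * Z \<omega>))"

end

theory Submission
  imports Defs
begin

text \<open>
  Multiplying the standard normal density by \<open>exp (t * z)\<close> amounts, after completing the square,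
  to moving its centre to \<open>t\<close> and scaling it by \<open>exp (t\<^sup>2 / 2)\<close>
  (\<open>std_normal_density_exp_tilt\<close>). The density of \<open>Z\<close> is a quartic polynomial times the standard
  normal density, so \<open>E (exp (t * Z))\<close> is \<open>exp (t\<^sup>2 / 2)\<close> times the mean of that quartic under the
  normal law with mean \<open>t\<close> and variance 1. Written in powers of \<open>z - t\<close>, the quartic is integrated by
  the central moments 1, 0, 1, 0, 3 (\<open>has_bochner_integral_normal_density_quartic\<close>), and rewriting
  the result in powers of \<open>t\<close> gives the bracket of the claim. The integral computation also yields
  integrability, and the constant quartic 1 gives the moment generating function of \<open>X\<close>.
\<close>

text \<open>
  The exponents agree because \<open>- z\<^sup>2 / 2 + t * z = t\<^sup>2 / 2 - (z - t)\<^sup>2 / 2\<close>. Stated for densities rather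
  than integrals, this replaces a change of variables \<open>z \<mapsto> z + t\<close> by the central moments of a
  shifted normal law.
\<close>

lemma std_normal_density_exp_tilt:
  "std_normal_density z * exp (t * z) = exp (t\<^sup>2 / 2) * normal_density t 1 z"
proof -
  have "- z\<^sup>2 / 2 + t * z = t\<^sup>2 / 2 + - (z - t)\<^sup>2 / 2"
    by (simp add: power2_eq_square field_simps)
  then have "exp (- z\<^sup>2 / 2) * exp (t * z) = exp (t\<^sup>2 / 2) * exp (- (z - t)\<^sup>2 / 2)"
    by (simp only: exp_add[symmetric])
  then show ?thesis
    by (simp add: normal_density_def)
qed

lemma has_bochner_integral_normal_density_quartic:
  fixes m c0 c1 c2 c3 c4 :: real
  shows "has_bochner_integral lborel
    (\<lambda>z. normal_density m 1 z *
      (c0 + c1 * (z - m) + c2 * (z - m)^2 + c3 * (z - m)^3 + c4 * (z - m)^4))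
    (c0 + c2 + 3 * c4)"
proof -
  have m0: "has_bochner_integral lborel (\<lambda>z. normal_density m 1 z) 1"
    using normal_moment_even[of 1 m 0] by simp
  have m1: "has_bochner_integral lborel (\<lambda>z. normal_density m 1 z * (z - m)) 0"
    using normal_moment_odd[of 1 m 0] by simp
  have m2: "has_bochner_integral lborel (\<lambda>z. normal_density m 1 z * (z - m)^2) 1"
    using normal_moment_even[of 1 m 1] by simp
  have m3: "has_bochner_integral lborel (\<lambda>z. normal_density m 1 z * (z - m)^3) 0"
    using normal_moment_odd[of 1 m 1] by (simp add: eval_nat_numeral)
  have m4: "has_bochner_integral lborel (\<lambda>z. normal_density m 1 z * (z - m)^4) 3"
    using normal_moment_even[of 1 m 2] by (simp add: fact_numeral)
  have "has_bochner_integral lborel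
    (\<lambda>z. normal_density m 1 z * c0 + normal_density m 1 z * (z - m) * c1
       + normal_density m 1 z * (z - m)^2 * c2 + normal_density m 1 z * (z - m)^3 * c3
       + normal_density m 1 z * (z - m)^4 * c4)
    (1 * c0 + 0 * c1 + 1 * c2 + 0 * c3 + 3 * c4)"
    by (intro has_bochner_integral_add has_bochner_integral_mult_left m0 m1 m2 m3 m4)
  then show ?thesis
    by (simp add: algebra_simps)
qed

text \<open>
  Positivity of the normalising factor makes the density nonnegative, which is what allows
  integrals over the probability space to be computed as real integrals against the density.
\<close>

lemma C2_pos: "C2 \<alpha> > 0"
proof -
  have "4 / (2 + \<alpha>\<^sup>2) \<le> 2"
    by (simp add: field_simps add_pos_nonneg)
  then show ?thesis
    by (simp add: C2_def)
qed

lemma basn2_density_nonneg: "0 \<le> basn2_density \<alpha> z"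
  using C2_pos[of \<alpha>] by (simp add: basn2_density_def)

lemma has_bochner_integral_std_normal_density_exp:
  "has_bochner_integral lborel (\<lambda>x. std_normal_density x * exp (t * x)) (exp (t\<^sup>2 / 2))"
  using has_bochner_integral_mult_right
      [OF has_bochner_integral_normal_density_quartic[of t 1 0 0 0 0], of "exp (t\<^sup>2 / 2)"]
  by (simp add: std_normal_density_exp_tilt)

text \<open>
  Tilting turns the integrand into a constant times \<open>((1 - \<alpha> * z)\<^sup>2 + 1)\<^sup>2\<close> times the normal density
  centred at \<open>t\<close>; expanding the polynomial about \<open>t\<close> reduces the integral to the central moments.
\<close>

lemma has_bochner_integral_basn2_density_exp:
  "has_bochner_integral lborel (\<lambda>z. basn2_density \<alpha> z * exp (t * z))
    (exp (t\<^sup>2 / 2) *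
      (\<alpha>^4 * t^4 + 6 * \<alpha>^4 * t^2 + 3 * \<alpha>^4 - 4 * \<alpha>^3 * t^3 - 12 * \<alpha>^3 * t
        + 8 * \<alpha>^2 * t^2 + 8 * \<alpha>^2 - 8 * \<alpha> * t + 4)
      / (C2 \<alpha> * (2 + \<alpha>^2)^2))"
    (is "has_bochner_integral lborel ?f ?I")
proof -
  define b where "b = 1 - \<alpha> * t"
  define k where "k = exp (t\<^sup>2 / 2) / (C2 \<alpha> * (2 + \<alpha>\<^sup>2)\<^sup>2)"
  \<comment> \<open>The coefficients of \<open>((1 - \<alpha> * z)\<^sup>2 + 1)\<^sup>2\<close> in powers of \<open>z - t\<close>, from
    \<open>1 - \<alpha> * z = b - \<alpha> * (z - t)\<close>.\<close>
  define c0 c1 c2 c3 c4 where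
    "c0 = (b\<^sup>2 + 1)\<^sup>2" and "c1 = - 4 * \<alpha> * b * (b\<^sup>2 + 1)" and "c2 = \<alpha>\<^sup>2 * (6 * b\<^sup>2 + 2)"
    and "c3 = - 4 * \<alpha>^3 * b" and "c4 = \<alpha>^4"
  note c_defs = c0_def c1_def c2_def c3_def c4_def
  let ?q = "\<lambda>z. c0 + c1 * (z - t) + c2 * (z - t)^2 + c3 * (z - t)^3 + c4 * (z - t)^4"
  have quartic: "((1 - \<alpha> * z)\<^sup>2 + 1)\<^sup>2 = ?q z" for z
    unfolding c_defs b_def by algebra
  have f_eq: "?f z = k * (normal_density t 1 z * ?q z)" for z
  proof -
    have "?f z = ((1 - \<alpha> * z)\<^sup>2 + 1)\<^sup>2 / (C2 \<alpha> * (2 + \<alpha>\<^sup>2)\<^sup>2) * (std_normal_density z * exp (t * z))"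
      by (simp add: basn2_density_def power_divide)
    also have "\<dots> = k * (normal_density t 1 z * ((1 - \<alpha> * z)\<^sup>2 + 1)\<^sup>2)"
      by (simp add: std_normal_density_exp_tilt k_def)
    finally show ?thesis
      by (simp only: quartic)
  qed
  have "c0 + c2 + 3 * c4 =
      \<alpha>^4 * t^4 + 6 * \<alpha>^4 * t^2 + 3 * \<alpha>^4 - 4 * \<alpha>^3 * t^3 - 12 * \<alpha>^3 * t
        + 8 * \<alpha>^2 * t^2 + 8 * \<alpha>^2 - 8 * \<alpha> * t + 4"
    unfolding c_defs b_def by algebra
  then have I_eq: "?I = k * (c0 + c2 + 3 * c4)"
    by (simp add: k_def)
  show ?thesis
    unfolding f_eq I_eq
    by (intro has_bochner_integral_mult_right has_bochner_integral_normal_density_quartic)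
qed

lemma mgf_of_distributed:
  assumes "distributed M lborel Y (\<lambda>y. ennreal (f y))"
    and "\<And>y. 0 \<le> f y"
    and "has_bochner_integral lborel (\<lambda>y. f y * exp (t * y)) I"
  shows "integrable M (\<lambda>\<omega>. exp (t * Y \<omega>))" and "mgf M Y t = I"
proof -
  have "integrable lborel (\<lambda>y. f y * exp (t * y))"
    using assms(3) by (rule integrable.intros)
  then show "integrable M (\<lambda>\<omega>. exp (t * Y \<omega>))"
    using distributed_integrable[OF assms(1), of "\<lambda>y. exp (t * y)"] assms(2) by simp
  have "(\<integral>y. f y * exp (t * y) \<partial>lborel) = mgf M Y t"
    unfolding mgf_def
    using distributed_integral[OF assms(1), of "\<lambda>y. exp (t * y)"] assms(2) by simp
  then show "mgf M Y t = I"
    using has_bochner_integral_integral_eq[OF assms(3)] by simp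
qed

theorem proposition3:
  fixes M :: "'a measure" and N :: "'b measure"
    and Z :: "'a \<Rightarrow> real" and X :: "'b \<Rightarrow> real" and \<alpha> :: real
  assumes "prob_space M"
    and "distributed M lborel Z (\<lambda>z. ennreal (basn2_density \<alpha> z))"
    and "prob_space N"
    and "distributed N lborel X (\<lambda>x. ennreal (std_normal_density x))"
  shows "\<forall>t::real.
      integrable M (\<lambda>\<omega>. exp (t * Z \<omega>)) \<and>
      mgf M Z t =
        mgf N X t *
          (\<alpha>^4 * t^4 + 6 * \<alpha>^4 * t^2 + 3 * \<alpha>^4 - 4 * \<alpha>^3 * t^3 - 12 * \<alpha>^3 * t
            + 8 * \<alpha>^2 * t^2 + 8 * \<alpha>^2 - 8 * \<alpha> * t + 4)
        / (C2 \<alpha> * (2 + \<alpha>^2)^2) \<and>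
      integrable N (\<lambda>\<omega>. exp (t * X \<omega>)) \<and>
      mgf N X t = exp (t^2 / 2)"
proof (intro allI conjI)
  fix t :: real
  note Z = mgf_of_distributed
    [OF assms(2) basn2_density_nonneg has_bochner_integral_basn2_density_exp, of t]
  note X = mgf_of_distributed
    [OF assms(4) normal_density_nonneg has_bochner_integral_std_normal_density_exp, of t]
  show "integrable M (\<lambda>\<omega>. exp (t * Z \<omega>))" and "integrable N (\<lambda>\<omega>. exp (t * X \<omega>))"
    and "mgf N X t = exp (t^2 / 2)"
    using Z(1) X by simp_all
  show "mgf M Z t =
        mgf N X t *
          (\<alpha>^4 * t^4 + 6 * \<alpha>^4 * t^2 + 3 * \<alpha>^4 - 4 * \<alpha>^3 * t^3 - 12 * \<alpha>^3 * t
            + 8 * \<alpha>^2 * t^2 + 8 * \<alpha>^2 - 8 * \<alpha> * t + 4)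
        / (C2 \<alpha> * (2 + \<alpha>^2)^2)"
    unfolding X(2) by (rule Z(2))
qed

end
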